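(* Let $\emptyset\neq\mathcal{X}\subseteq\{0,1\}^n$ with $n\ge1$, $\hat c\in\mathbb{R}^n_{\ge0}$, $d\in\mathbb{R}^n$ with $d_i>0$ for all $i$, and let $B=\{c\in\mathbb{R}^n:\sum_i|c_i|/d_i\le1\}$ be the unit ball of the generalized Manhattan norm. Then the variable-sized robust problem can be solved in time $O(nT)$, and the resulting set satisfies $|\mathcal{S}|\le n$.
   Context: For $\lambda\ge0$ let $\mathcal{U}_\lambda=\{\hat c\}+\lambda B$ and consider $\mathsf{P}(\lambda)$: $\min_{x\in\mathcal{X}}\max_{c\in\mathcal{U}_\lambda}c^tx$ (its objective equals $\hat c^tx+\lambda\max_id_ix_i$). Solving the variable-sized robust problem means computing a set $\mathcal{S}\subset\mathcal{X}$ of smallest possible size such that for every $\lambda\ge0$, $\mathcal{S}$ contains an optimal solution of $\mathsf{P}(\lambda)$. $T$ denotes the time necessary to solve the nominal problem $\min\{c^tx:x\in\mathcal{X}\}$ for a given nonnegative cost vector $c$. *)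

theory Defs
  imports "Jordan_Normal_Form.Matrix"
begin

section \<open>The variable-sized robust problem\<close>

definition binary_vecs :: "nat \<Rightarrow> real vec set" where
  "binary_vecs n = {x \<in> carrier_vec n. \<forall>i<n. x $ i \<in> {0, 1}}"

definition manhattan_ball :: "nat \<Rightarrow> real vec \<Rightarrow> real vec set" where
  "manhattan_ball n d = {c \<in> carrier_vec n. (\<Sum>i<n. \<bar>c $ i\<bar> / d $ i) \<le> 1}"

definition uncertainty_set :: "nat \<Rightarrow> real vec \<Rightarrow> real vec \<Rightarrow> real \<Rightarrow> real vec set" where
  "uncertainty_set n c0 d l = {c0 + l \<cdot>\<^sub>v b | b. b \<in> manhattan_ball n d}"

definition worst_case :: "nat \<Rightarrow> real vec \<Rightarrow> real vec \<Rightarrow> real \<Rightarrow> real vec \<Rightarrow> real" where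
  "worst_case n c0 d l x = (GREATEST v. \<exists>c \<in> uncertainty_set n c0 d l. v = c \<bullet> x)"

definition robust_optimal ::
  "nat \<Rightarrow> real vec set \<Rightarrow> real vec \<Rightarrow> real vec \<Rightarrow> real \<Rightarrow> real vec \<Rightarrow> bool" where
  "robust_optimal n X c0 d l x \<longleftrightarrow> is_arg_min (worst_case n c0 d l) (\<lambda>x. x \<in> X) x"

definition covers_all_sizes ::
  "nat \<Rightarrow> real vec set \<Rightarrow> real vec \<Rightarrow> real vec \<Rightarrow> real vec set \<Rightarrow> bool" where
  "covers_all_sizes n X c0 d S \<longleftrightarrow>
     S \<subseteq> X \<and> (\<forall>l\<ge>0. \<exists>x\<in>S. robust_optimal n X c0 d l x)"

definition variable_sized_solution ::
  "nat \<Rightarrow> real vec set \<Rightarrow> real vec \<Rightarrow> real vec \<Rightarrow> real vec set \<Rightarrow> bool" where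
  "variable_sized_solution n X c0 d S \<longleftrightarrow> is_arg_min card (covers_all_sizes n X c0 d) S"


section \<open>Algorithms with access to a nominal solver\<close>

text \<open>
  The machine model is a unit-cost real RAM: exact real arithmetic and comparisons, and a separate
  memory of natural numbers for addresses and counters, without multiplication on the latter and
  without any conversion between the two. Memory consists of named arrays, cell 0 of an array
  serving as a scalar variable. Programs are first-order syntax, so that a program cannot smuggle
  in an arbitrary function of the logic. Every command other than a call of the nominal solver takes
  one step (plus the steps of its subcommands); the expressions in a fixed program have bounded
  size, so charging for the single operations in them would only change constants.
\<close>

record state =
  imem :: "string \<Rightarrow> nat \<Rightarrow> nat"
  rmem :: "string \<Rightarrow> nat \<Rightarrow> real"

datatype iexp =
    INum nat
  | IGet string iexp
  | IAdd iexp iexp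
  | ISub iexp iexp

datatype rexp =
    RNum nat
  | RGet string iexp
  | RAdd rexp rexp
  | RSub rexp rexp
  | RMul rexp rexp
  | RDiv rexp rexp

datatype bexp =
    ILess iexp iexp
  | RLess rexp rexp
  | Neg bexp
  | Conj bexp bexp

datatype com =
    Skip
  | IAssign string iexp iexp
  | RAssign string iexp rexp
  | Seq com com
  | Cond bexp com com
  | While bexp com
  | Solve string string

fun ival :: "iexp \<Rightarrow> state \<Rightarrow> nat" where
  "ival (INum k) s = k"
| "ival (IGet a e) s = imem s a (ival e s)"
| "ival (IAdd e f) s = ival e s + ival f s"
| "ival (ISub e f) s = ival e s - ival f s"

fun rval :: "rexp \<Rightarrow> state \<Rightarrow> real" where
  "rval (RNum k) s = real k"
| "rval (RGet a e) s = rmem s a (ival e s)"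
| "rval (RAdd e f) s = rval e s + rval f s"
| "rval (RSub e f) s = rval e s - rval f s"
| "rval (RMul e f) s = rval e s * rval f s"
| "rval (RDiv e f) s = rval e s / rval f s"

fun bval :: "bexp \<Rightarrow> state \<Rightarrow> bool" where
  "bval (ILess e f) s \<longleftrightarrow> ival e s < ival f s"
| "bval (RLess e f) s \<longleftrightarrow> rval e s < rval f s"
| "bval (Neg b) s \<longleftrightarrow> \<not> bval b s"
| "bval (Conj b c) s \<longleftrightarrow> bval b s \<and> bval c s"

definition iupd :: "string \<Rightarrow> nat \<Rightarrow> nat \<Rightarrow> state \<Rightarrow> state" where
  "iupd a j v s = s\<lparr>imem := (imem s)(a := (imem s a)(j := v))\<rparr>"

definition rupd :: "string \<Rightarrow> nat \<Rightarrow> real \<Rightarrow> state \<Rightarrow> state" where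
  "rupd a j v s = s\<lparr>rmem := (rmem s)(a := (rmem s a)(j := v))\<rparr>"

definition rupd_vec :: "string \<Rightarrow> nat \<Rightarrow> real vec \<Rightarrow> state \<Rightarrow> state" where
  "rupd_vec a n x s =
     s\<lparr>rmem := (rmem s)(a := (\<lambda>i. if i < n then x $ i else rmem s a i))\<rparr>"

text \<open>
  \<open>exec n sol T p s t s'\<close>: started in \<open>s\<close>, the program \<open>p\<close> halts in \<open>s'\<close> after \<open>t\<close> steps.
  The command \<open>Solve q a\<close> submits the first \<open>n\<close> cells of array \<open>q\<close> as cost vector to the nominal
  solver \<open>sol\<close>, whose answer is placed in the first \<open>n\<close> cells of array \<open>a\<close>; this takes \<open>T\<close> steps.
\<close>

inductive exec ::
  "nat \<Rightarrow> (real vec \<Rightarrow> real vec) \<Rightarrow> nat \<Rightarrow> com \<Rightarrow> state \<Rightarrow> nat \<Rightarrow> state \<Rightarrow> bool"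
  for n :: nat and sol :: "real vec \<Rightarrow> real vec" and T :: nat where
  Skip: "exec n sol T Skip s 1 s"
| IAssign: "exec n sol T (IAssign a e f) s 1 (iupd a (ival e s) (ival f s) s)"
| RAssign: "exec n sol T (RAssign a e f) s 1 (rupd a (ival e s) (rval f s) s)"
| Seq: "\<lbrakk>exec n sol T p s t s'; exec n sol T q s' u s''\<rbrakk>
    \<Longrightarrow> exec n sol T (Seq p q) s (t + u) s''"
| CondTrue: "\<lbrakk>bval b s; exec n sol T p s t s'\<rbrakk> \<Longrightarrow> exec n sol T (Cond b p q) s (1 + t) s'"
| CondFalse: "\<lbrakk>\<not> bval b s; exec n sol T q s t s'\<rbrakk> \<Longrightarrow> exec n sol T (Cond b p q) s (1 + t) s'"
| WhileFalse: "\<not> bval b s \<Longrightarrow> exec n sol T (While b p) s 1 s"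
| WhileTrue: "\<lbrakk>bval b s; exec n sol T p s t s'; exec n sol T (While b p) s' u s''\<rbrakk>
    \<Longrightarrow> exec n sol T (While b p) s (1 + t + u) s''"
| Solve: "exec n sol T (Solve q a) s T (rupd_vec a n (sol (vec n (rmem s q))) s)"

inductive_cases exec_elims:
  "exec n sol T Skip s t s'"
  "exec n sol T (IAssign a e f) s t s'"
  "exec n sol T (RAssign a e f) s t s'"
  "exec n sol T (Seq p q) s t s'"
  "exec n sol T (Cond b p q) s t s'"
  "exec n sol T (While b p) s t s'"
  "exec n sol T (Solve q a) s t s'"

lemma exec_deterministic:
  "exec n sol T p s t s' \<Longrightarrow> exec n sol T p s u s'' \<Longrightarrow> u = t \<and> s'' = s'"
proof (induction arbitrary: u s'' rule: exec.induct)
  case Skip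
  then show ?case by (elim exec_elims) simp
next
  case IAssign
  then show ?case by (elim exec_elims) simp
next
  case RAssign
  then show ?case by (elim exec_elims) simp
next
  case Seq
  from Seq.prems show ?case by (rule exec_elims) (auto dest!: Seq.IH)
next
  case CondTrue
  from CondTrue.prems show ?case by (rule exec_elims) (use CondTrue.hyps(1) in \<open>auto dest!: CondTrue.IH\<close>)
next
  case CondFalse
  from CondFalse.prems show ?case by (rule exec_elims) (use CondFalse.hyps(1) in \<open>auto dest!: CondFalse.IH\<close>)
next
  case WhileFalse
  from WhileFalse.prems show ?case by (rule exec_elims) (use WhileFalse.hyps in auto)
next
  case WhileTrue
  from WhileTrue.prems show ?case by (rule exec_elims) (use WhileTrue.hyps(1) in \<open>auto dest!: WhileTrue.IH\<close>)
next
  case Solve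
  then show ?case by (elim exec_elims) simp
qed

text \<open>
  Time \<open>T\<close> includes writing the \<open>n\<close> entries of the answer, hence \<open>n \<le> T\<close>. The solver is only
  required to work on nonnegative cost vectors; its answer to any other query is arbitrary.
\<close>

definition nominal_solver ::
  "nat \<Rightarrow> real vec set \<Rightarrow> (real vec \<Rightarrow> real vec) \<Rightarrow> nat \<Rightarrow> bool" where
  "nominal_solver n X sol T \<longleftrightarrow> n \<le> T \<and>
     (\<forall>c \<in> carrier_vec n. (\<forall>i<n. 0 \<le> c $ i) \<longrightarrow>
        is_arg_min (\<lambda>x. c \<bullet> x) (\<lambda>x. x \<in> X) (sol c))"

text \<open>The feasible set is not part of the input: it is accessible only through the solver.\<close>

definition input_state :: "nat \<Rightarrow> real vec \<Rightarrow> real vec \<Rightarrow> state" where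
  "input_state n c0 d =
     rupd_vec ''c'' n c0 (rupd_vec ''d'' n d (iupd ''n'' 0 n
       \<lparr>imem = (\<lambda>_ _. 0), rmem = (\<lambda>_ _. 0)\<rparr>))"

text \<open>
  The result is the set of the first \<open>m\<close> rows, stored consecutively in array \<open>S\<close>, where \<open>m\<close> is
  the content of the scalar \<open>m\<close>.
\<close>

definition output_set :: "nat \<Rightarrow> state \<Rightarrow> real vec set" where
  "output_set n s = {vec n (\<lambda>i. rmem s ''S'' (j * n + i)) | j. j < imem s ''m'' 0}"

end

theory Submission imports Defs begin

text \<open>
  The worst case of \<open>x\<close> for size \<open>l\<close> is \<open>cost x + l * spread x\<close>, a line in \<open>l\<close>, where \<open>spread x\<close> is the
  largest \<open>d $ i\<close> with \<open>x $ i = 1\<close>. For every possible value of \<open>spread\<close>, one nominal problem, in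
  which the items with larger \<open>d $ i\<close> get a prohibitive cost, yields a cheapest solution whose spread
  does not exceed that value. These \<open>n + 1\<close> candidates suffice for all sizes, and a smallest
  solution consists of one candidate for each piece of the lower envelope of their lines. To decide
  whether a candidate owns a piece, let \<open>L \<ge> 0\<close> be the smallest size from which on no candidate of
  larger spread is strictly better; the candidate must then be optimal for \<open>L\<close>, with least spread among
  the optimal ones. This takes time \<open>O(n)\<close> per candidate, hence \<open>O(n\<^sup>2)\<close> in total, and \<open>n \<le> T\<close>.
\<close>

section \<open>Selecting the vertices of a lower envelope of lines\<close>

text \<open>An abscissa rather than a gradient: line \<open>k\<close> has intercept
  \<open>f k\<close> and gradient \<open>g k\<close>, and the quotients are its crossings with
  steeper lines. The inserted 0 confines the search to nonnegative sizes.\<close>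

definition slope :: "(nat \<Rightarrow> real) \<Rightarrow> (nat \<Rightarrow> real) \<Rightarrow> nat \<Rightarrow> nat \<Rightarrow> real" where
  "slope f g N k = Max (insert 0 ((\<lambda>j. (f k - f j) / (g j - g k)) ` {j. j < N \<and> g k < g j}))"

text \<open>The lexicographic order on value at \<open>l\<close>, gradient and index. The index
  breaks ties between lines that agree in the other two. Writing it without equality matches the
  comparisons available to programs.\<close>

definition beats :: "(nat \<Rightarrow> real) \<Rightarrow> (nat \<Rightarrow> real) \<Rightarrow> real \<Rightarrow> nat \<Rightarrow> nat \<Rightarrow> bool" where
  "beats f g l j k \<longleftrightarrow> f j + l * g j < f k + l * g k \<or>
     (f j + l * g j \<le> f k + l * g k \<and> (g j < g k \<or> (g j \<le> g k \<and> j < k)))"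

definition selected :: "(nat \<Rightarrow> real) \<Rightarrow> (nat \<Rightarrow> real) \<Rightarrow> nat \<Rightarrow> nat set" where
  "selected f g N = {k. k < N \<and> (\<forall>j<N. \<not> beats f g (slope f g N k) j k)}"

lemma slope_0 [simp]: "slope f g 0 k = 0"
  by (simp add: slope_def)

text \<open>The recurrence that one round of the loop in \<open>slope_com\<close> carries
  out.\<close>

lemma slope_Suc:
  "slope f g (Suc N) k =
     (if g k < g N then max (slope f g N k) ((f k - f N) / (g N - g k)) else slope f g N k)"
proof (cases "g k < g N")
  case True
  then have "{j. j < Suc N \<and> g k < g j} = insert N {j. j < N \<and> g k < g j}"
    by (auto simp: less_Suc_eq)
  then show ?thesis
    using True by (simp add: slope_def insert_commute[of 0] max.commute)
next
  case False
  then have "{j. j < Suc N \<and> g k < g j} = {j. j < N \<and> g k < g j}"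
    by (auto simp: less_Suc_eq)
  then show ?thesis
    using False by (simp add: slope_def)
qed

lemma slope_nonneg: "0 \<le> slope f g N k"
  by (simp add: slope_def)

lemma slope_ge: "j < N \<Longrightarrow> g k < g j \<Longrightarrow> (f k - f j) / (g j - g k) \<le> slope f g N k"
  by (auto simp: slope_def intro!: Max_ge)

lemma slope_le:
  assumes "0 \<le> l" and "\<And>j. j < N \<Longrightarrow> g k < g j \<Longrightarrow> (f k - f j) / (g j - g k) \<le> l"
  shows "slope f g N k \<le> l"
  using assms by (auto simp: slope_def)

lemma ex_unbeaten: "\<exists>k<Suc N. \<forall>j<Suc N. \<not> beats f g l j k"
proof (induction N)
  case 0
  then show ?case by (simp add: beats_def)
next
  case (Suc N)
  then obtain k where k: "k < Suc N" "\<And>j. j < Suc N \<Longrightarrow> \<not> beats f g l j k"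
    by blast
  show ?case
  proof (cases "beats f g l (Suc N) k")
    case True
    have "\<not> beats f g l j (Suc N)" if "j < Suc (Suc N)" for j
    proof (cases "j = Suc N")
      case True
      then show ?thesis by (simp add: beats_def)
    next
      case False
      then have "\<not> beats f g l j k" using k that by auto
      \<comment> \<open>Transitivity of the lexicographic order. The newcomer \<open>Suc N\<close>
        has the largest index, so it can have won only by value or gradient.\<close>
      with \<open>beats f g l (Suc N) k\<close> k(1) that show ?thesis
        by (auto simp: beats_def)
    qed
    then show ?thesis by blast
  next
    case False
    with k show ?thesis by (metis less_Suc_eq)
  qed
qed

text \<open>The line \<open>k\<close> that is unbeaten at \<open>l\<close> is itself selected: its
  abscissa \<open>?L\<close> lies at or to the left of \<open>l\<close>, and \<open>k\<close> stays
  unbeaten when moving from \<open>l\<close> back to \<open>?L\<close>.\<close>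

lemma selected_covers:
  assumes "0 \<le> l" and "0 < N"
  obtains k where "k \<in> selected f g N" and "\<And>j. j < N \<Longrightarrow> f k + l * g k \<le> f j + l * g j"
proof -
  obtain k where k: "k < N" and unbeaten: "\<And>j. j < N \<Longrightarrow> \<not> beats f g l j k"
    using ex_unbeaten[of "N - 1" f g l] assms(2) by auto
  have opt: "f k + l * g k \<le> f j + l * g j" if "j < N" for j
    using unbeaten[OF that] by (auto simp: beats_def)
  let ?L = "slope f g N k"
  have L: "?L \<le> l"
  proof (rule slope_le[OF assms(1)])
    fix j assume "j < N" "g k < g j"
    with opt[of j] show "(f k - f j) / (g j - g k) \<le> l"
      by (simp add: field_simps)
  qed
  have "\<not> beats f g ?L j k" if j: "j < N" for j
  proof (cases "g k < g j")
    case True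
    \<comment> \<open>By the choice of \<open>?L\<close>, a steeper line is not below
      \<open>k\<close> there, and it loses a tie by its gradient.\<close>
    with slope_ge[OF j True, of f] have "f k + ?L * g k \<le> f j + ?L * g j"
      by (simp add: field_simps)
    with True show ?thesis by (auto simp: beats_def)
  next
    case False
    \<comment> \<open>Moving left by \<open>l - ?L\<close> lowers \<open>k\<close> at least as much
      as a line that is no steeper, so \<open>j\<close> gains nothing.\<close>
    then have "(l - ?L) * g j \<le> (l - ?L) * g k"
      using L by (intro mult_left_mono) auto
    with unbeaten[OF j] False show ?thesis
      by (auto simp: beats_def algebra_simps)
  qed
  with k have "k \<in> selected f g N" by (auto simp: selected_def)
  with opt show thesis using that by blast
qed

text \<open>Between lines of equal gradient the abscissa is irrelevant: intercept and index alone
  decide, and this is a total order.\<close>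

lemma inj_on_selected: "inj_on g (selected f g N)"
proof (rule inj_onI)
  fix k k' assume *: "k \<in> selected f g N" "k' \<in> selected f g N" "g k = g k'"
  then have "\<not> beats f g (slope f g N k) k' k" "\<not> beats f g (slope f g N k') k k'"
    by (auto simp: selected_def)
  with *(3) show "k = k'" by (auto simp: beats_def)
qed

text \<open>Slightly to the right of its slope, a selected line lies strictly below all lines of another
  gradient.\<close>

lemma selected_strictly_optimal:
  assumes "k \<in> selected f g N"
  obtains l where "0 < l"
    and "\<And>j. j < N \<Longrightarrow> f j + l * g j \<le> f k + l * g k \<Longrightarrow> g j = g k"
proof -
  let ?L = "slope f g N k"
  \<comment> \<open>Handled one line at a time; the finitely many right neighbourhoods are
    intersected afterwards.\<close>
  have "\<forall>\<^sub>F l in at_right ?L. f j + l * g j \<le> f k + l * g k \<longrightarrow> g j = g k" if j: "j < N" for j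
  proof (cases "g k < g j")
    case True
    have "f k + l * g k < f j + l * g j" if "?L < l" for l
    proof -
      have "?L * (g j - g k) < l * (g j - g k)"
        using True that by (intro mult_strict_right_mono) auto
      with slope_ge[OF j True, of f] True show ?thesis
        by (simp add: field_simps)
    qed
    then show ?thesis
      by (intro eventually_mono[OF eventually_at_right_less]) (simp add: not_le[symmetric])
  next
    case False
    show ?thesis
    proof (cases "g j = g k")
      case neq: False
      \<comment> \<open>A less steep line would win a tie at \<open>?L\<close>, so being unbeaten
        makes the inequality strict; continuity then carries it a little to the right.\<close>
      have "f k + ?L * g k < f j + ?L * g j"
        using assms j False neq by (force simp: selected_def beats_def)
      moreover have "((\<lambda>l. (f j + l * g j) - (f k + l * g k)) \<longlongrightarrow>
          (f j + ?L * g j) - (f k + ?L * g k)) (at_right ?L)"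
        by (intro tendsto_intros)
      ultimately have "\<forall>\<^sub>F l in at_right ?L. 0 < (f j + l * g j) - (f k + l * g k)"
        by (intro order_tendstoD(1)) auto
      then show ?thesis by eventually_elim auto
    qed simp
  qed
  then have "\<forall>\<^sub>F l in at_right ?L. \<forall>j\<in>{..<N}. f j + l * g j \<le> f k + l * g k \<longrightarrow> g j = g k"
    by (intro eventually_ball_finite) auto
  moreover have "\<forall>\<^sub>F l in at_right ?L. ?L < l"
    by (simp add: eventually_at_right_less)
  ultimately have "\<forall>\<^sub>F l in at_right ?L. 0 < l \<and> (\<forall>j\<in>{..<N}. f j + l * g j \<le> f k + l * g k \<longrightarrow> g j = g k)"
    by eventually_elim (use slope_nonneg[of f g N k] in auto)
  then obtain l where "0 < l" "\<forall>j\<in>{..<N}. f j + l * g j \<le> f k + l * g k \<longrightarrow> g j = g k"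
    using eventually_happens'[OF trivial_limit_at_right_real] by blast
  then show thesis using that by blast
qed


section \<open>Reduction to nominal problems\<close>

locale robust_instance =
  fixes n :: nat and X :: "real vec set" and c0 d :: "real vec"
    and sol :: "real vec \<Rightarrow> real vec" and T :: nat
  assumes n_pos: "1 \<le> n"
    and X_binary: "X \<subseteq> binary_vecs n"
    and c0_carrier: "c0 \<in> carrier_vec n"
    and c0_nonneg: "\<And>i. i < n \<Longrightarrow> 0 \<le> c0 $ i"
    and d_pos: "\<And>i. i < n \<Longrightarrow> 0 < d $ i"
    and solver: "nominal_solver n X sol T"
begin

definition cost :: "real vec \<Rightarrow> real" where
  "cost x = (\<Sum>i<n. c0 $ i * x $ i)"

text \<open>The inserted 0 is the starting value of the running maximum in
  \<open>evaluate_com\<close>.\<close>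

definition spread :: "real vec \<Rightarrow> real" where
  "spread x = Max (insert 0 ((\<lambda>i. d $ i * x $ i) ` {..<n}))"

definition penalty :: real where
  "penalty = 1 + (\<Sum>i<n. c0 $ i)"

text \<open>The threshold 0 for \<open>k = n\<close> detects the zero vector; on the machine it is the untouched cell \<open>n\<close>
  of array \<open>d\<close>.\<close>

definition threshold :: "nat \<Rightarrow> real" where
  "threshold k = (if k < n then d $ k else 0)"

text \<open>As \<open>X\<close> is accessible only through the solver, items are excluded by their
  cost instead of by restricting \<open>X\<close>.\<close>

definition query :: "nat \<Rightarrow> real vec" where
  "query k = vec n (\<lambda>i. if threshold k < d $ i then penalty else c0 $ i)"

definition candidate :: "nat \<Rightarrow> real vec" where
  "candidate k = sol (query k)"

abbreviation kept :: "nat set" where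
  "kept \<equiv> selected (cost \<circ> candidate) (spread \<circ> candidate) (Suc n)"

lemma X_carrier: "x \<in> X \<Longrightarrow> x \<in> carrier_vec n"
  using X_binary by (auto simp: binary_vecs_def)

lemma X_entry: "x \<in> X \<Longrightarrow> i < n \<Longrightarrow> x $ i = 0 \<or> x $ i = 1"
  using X_binary by (auto simp: binary_vecs_def)

lemma X_entry_nonneg: "x \<in> X \<Longrightarrow> i < n \<Longrightarrow> 0 \<le> x $ i"
  using X_entry by fastforce

text \<open>Needed for counting: \<open>card\<close> is 0 on infinite sets, so an infinite cover
  would spoil minimality.\<close>

lemma finite_X: "finite X"
proof (rule finite_subset[OF X_binary], rule finite_surj)
  show "finite (PiE {..<n} (\<lambda>_. {0, 1 :: real}))"
    by (intro finite_PiE) auto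
  show "binary_vecs n \<subseteq> (\<lambda>h. vec n h) ` PiE {..<n} (\<lambda>_. {0, 1})"
  proof
    fix x :: "real vec" assume x: "x \<in> binary_vecs n"
    then have "x = vec n (restrict (\<lambda>i. x $ i) {..<n})"
      by (auto simp: binary_vecs_def)
    moreover have "restrict (\<lambda>i. x $ i) {..<n} \<in> PiE {..<n} (\<lambda>_. {0, 1})"
      using x by (auto simp: binary_vecs_def)
    ultimately show "x \<in> (\<lambda>h. vec n h) ` PiE {..<n} (\<lambda>_. {0, 1})"
      by blast
  qed
qed

lemma spread_nonneg: "0 \<le> spread x"
  by (simp add: spread_def)

lemma spread_ge: "i < n \<Longrightarrow> d $ i * x $ i \<le> spread x"
  by (simp add: spread_def)

lemma spread_cases:
  obtains "spread x = 0" | i where "i < n" "spread x = d $ i * x $ i"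
proof -
  have "spread x \<in> insert 0 ((\<lambda>i. d $ i * x $ i) ` {..<n})"
    unfolding spread_def by (rule Max_in) auto
  then show thesis using that by auto
qed

section \<open>The worst case over the ball as a line in the size\<close>

lemma scalar_prod_X: "x \<in> X \<Longrightarrow> c \<bullet> x = (\<Sum>i<n. c $ i * x $ i)"
  using X_carrier by (fastforce simp: scalar_prod_def atLeast0LessThan)

text \<open>Hoelder's inequality for the weighted 1-norm and its dual, the weighted maximum norm:
  each term is \<open>\<bar>b $ i\<bar> / d $ i\<close> times \<open>d $ i * x $ i\<close>, and the
  first factors sum to at most 1.\<close>

lemma ball_prod_le:
  assumes b: "b \<in> manhattan_ball n d" and x: "x \<in> X"
  shows "(\<Sum>i<n. b $ i * x $ i) \<le> spread x"
proof -
  have "(\<Sum>i<n. b $ i * x $ i) \<le> (\<Sum>i<n. \<bar>b $ i\<bar> / d $ i * spread x)"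
  proof (rule sum_mono)
    fix i assume "i \<in> {..<n}"
    then have i: "i < n" by simp
    have "b $ i * x $ i \<le> \<bar>b $ i\<bar> * x $ i"
      using X_entry_nonneg[OF x i] by (intro mult_right_mono) auto
    also have "\<dots> = \<bar>b $ i\<bar> / d $ i * (d $ i * x $ i)"
      using d_pos[OF i] by simp
    also have "\<dots> \<le> \<bar>b $ i\<bar> / d $ i * spread x"
      using d_pos[OF i] spread_ge[OF i] by (intro mult_left_mono) auto
    finally show "b $ i * x $ i \<le> \<bar>b $ i\<bar> / d $ i * spread x" .
  qed
  also have "\<dots> = (\<Sum>i<n. \<bar>b $ i\<bar> / d $ i) * spread x"
    by (simp add: sum_distrib_right)
  also have "\<dots> \<le> 1 * spread x"
    using b spread_nonneg by (intro mult_right_mono) (auto simp: manhattan_ball_def)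
  finally show ?thesis by simp
qed

lemma ball_prod_attained:
  assumes "x \<in> X"
  obtains b where "b \<in> manhattan_ball n d" and "(\<Sum>i<n. b $ i * x $ i) = spread x"
proof (cases rule: spread_cases[of x])
  case 1
  then have "(\<Sum>i<n. 0\<^sub>v n $ i * x $ i) = spread x" by simp
  moreover have "0\<^sub>v n \<in> manhattan_ball n d" by (simp add: manhattan_ball_def)
  ultimately show thesis using that by blast
next
  case (2 k)
  \<comment> \<open>All of the unit budget goes to the item \<open>k\<close> that attains the
    maximum.\<close>
  let ?b = "vec n (\<lambda>i. if i = k then d $ k else 0)"
  have "(\<Sum>i<n. ?b $ i * x $ i) = (\<Sum>i<n. if i = k then d $ k * x $ k else 0)"
    by (intro sum.cong) auto
  also have "\<dots> = spread x" using 2 by simp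
  finally have "(\<Sum>i<n. ?b $ i * x $ i) = spread x" .
  moreover have "(\<Sum>i<n. \<bar>?b $ i\<bar> / d $ i) = (\<Sum>i<n. if i = k then 1 else 0)"
    using d_pos[OF 2(1)] by (intro sum.cong) auto
  then have "?b \<in> manhattan_ball n d" by (simp add: manhattan_ball_def)
  ultimately show thesis using that by blast
qed

text \<open>\<open>GREATEST\<close> asks for an attained upper bound; the two preceding lemmas
  supply the attainment and the bound.\<close>

lemma worst_case_eq:
  assumes x: "x \<in> X" and l: "0 \<le> l"
  shows "worst_case n c0 d l x = cost x + l * spread x"
proof -
  have prod: "(c0 + l \<cdot>\<^sub>v b) \<bullet> x = cost x + l * (\<Sum>i<n. b $ i * x $ i)"
    if "b \<in> manhattan_ball n d" for b
  proof -
    have "b \<in> carrier_vec n" using that by (simp add: manhattan_ball_def)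
    then have "(c0 + l \<cdot>\<^sub>v b) \<bullet> x = (\<Sum>i<n. c0 $ i * x $ i + l * (b $ i * x $ i))"
      unfolding scalar_prod_X[OF x] using c0_carrier
      by (intro sum.cong) (auto simp: algebra_simps)
    then show ?thesis by (simp add: cost_def sum.distrib sum_distrib_left)
  qed
  show ?thesis
    unfolding worst_case_def
  proof (rule Greatest_equality)
    obtain b where "b \<in> manhattan_ball n d" "(\<Sum>i<n. b $ i * x $ i) = spread x"
      using ball_prod_attained[OF x] .
    with prod[of b] show "\<exists>c\<in>uncertainty_set n c0 d l. cost x + l * spread x = c \<bullet> x"
      by (auto simp: uncertainty_set_def)
  next
    fix v assume "\<exists>c\<in>uncertainty_set n c0 d l. v = c \<bullet> x"
    then show "v \<le> cost x + l * spread x"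
      using prod ball_prod_le[OF _ x] l
      by (auto simp: uncertainty_set_def intro!: mult_left_mono)
  qed
qed

lemma robust_optimal_iff:
  assumes "0 \<le> l"
  shows "robust_optimal n X c0 d l x \<longleftrightarrow>
    x \<in> X \<and> (\<forall>y\<in>X. cost x + l * spread x \<le> cost y + l * spread y)"
  using worst_case_eq[OF _ assms]
  by (auto simp: robust_optimal_def is_arg_min_def not_less[symmetric])

section \<open>Candidates from penalised nominal problems\<close>

lemma sum_c0_lt_penalty: "(\<Sum>i<n. c0 $ i) < penalty"
  by (simp add: penalty_def)

lemma query_nonneg: "i < n \<Longrightarrow> 0 \<le> query k $ i"
  using c0_nonneg by (auto simp: query_def penalty_def intro!: add_nonneg_nonneg sum_nonneg)

lemma candidate_in: "candidate k \<in> X"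
  and candidate_min: "y \<in> X \<Longrightarrow> query k \<bullet> candidate k \<le> query k \<bullet> y"
proof -
  have "query k \<in> carrier_vec n" by (simp add: query_def)
  then have "is_arg_min (\<lambda>x. query k \<bullet> x) (\<lambda>x. x \<in> X) (sol (query k))"
    using solver query_nonneg by (auto simp: nominal_solver_def)
  then show "candidate k \<in> X" and "y \<in> X \<Longrightarrow> query k \<bullet> candidate k \<le> query k \<bullet> y"
    by (auto simp: is_arg_min_def candidate_def not_less)
qed

text \<open>The query for the threshold \<open>spread x\<close> has value \<open>cost x\<close> at \<open>x\<close>, which is below the penalty.
  So its answer avoids all penalised entries.\<close>

lemma candidate_dominates:
  assumes x: "x \<in> X"
  obtains k where "k < Suc n" "cost (candidate k) \<le> cost x" "spread (candidate k) \<le> spread x"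
proof -
  obtain k where k: "k < Suc n" "threshold k = spread x"
  proof (cases rule: spread_cases[of x])
    case 1
    then show thesis using that[of n] by (simp add: threshold_def)
  next
    case (2 i)
    show thesis
    proof (cases "x $ i = 0")
      case True
      \<comment> \<open>The maximum is attained by an item outside \<open>x\<close>, hence equals 0,
        the threshold with index \<open>n\<close>.\<close>
      with 2 show thesis using that[of n] by (simp add: threshold_def)
    next
      case False
      with 2 X_entry[OF x] show thesis using that[of i] by (auto simp: threshold_def)
    qed
  qed
  let ?y = "candidate k"
  note y = candidate_in[of k]
  have "query k \<bullet> x = cost x"
    unfolding scalar_prod_X[OF x] cost_def
  proof (rule sum.cong)
    fix i assume "i \<in> {..<n}"
    then have i: "i < n" by simp
    have "x $ i = 0" if "spread x < d $ i"
      using X_entry[OF x i] spread_ge[OF i, of x] that by auto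
    then show "query k $ i * x $ i = c0 $ i * x $ i"
      using i k(2) by (auto simp: query_def)
  qed simp
  then have le: "(\<Sum>i<n. query k $ i * ?y $ i) \<le> cost x"
    using candidate_min[OF x, of k] by (simp add: scalar_prod_X[OF y])
  have "cost x \<le> (\<Sum>i<n. c0 $ i)"
    unfolding cost_def
  proof (rule sum_mono)
    fix i assume "i \<in> {..<n}"
    then show "c0 $ i * x $ i \<le> c0 $ i"
      using X_entry[OF x, of i] c0_nonneg[of i] by auto
  qed
  with le sum_c0_lt_penalty have lt: "(\<Sum>i<n. query k $ i * ?y $ i) < penalty"
    by linarith
  \<comment> \<open>A single penalised item would already cost \<open>penalty\<close>, as all other
    terms are nonnegative.\<close>
  have avoid: "?y $ i = 0" if i: "i < n" and "threshold k < d $ i" for i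
  proof (rule ccontr)
    assume "?y $ i \<noteq> 0"
    then have "penalty = query k $ i * ?y $ i"
      using X_entry[OF y i] that by (auto simp: query_def)
    also have "\<dots> \<le> (\<Sum>i<n. query k $ i * ?y $ i)"
      using i query_nonneg X_entry_nonneg[OF y] by (intro member_le_sum) auto
    finally show False using lt by simp
  qed
  have "cost ?y = (\<Sum>i<n. query k $ i * ?y $ i)"
    unfolding cost_def using avoid by (intro sum.cong) (auto simp: query_def)
  with le have "cost ?y \<le> cost x" by simp
  moreover have "spread ?y \<le> spread x"
  proof (cases rule: spread_cases[of ?y])
    case 1
    then show ?thesis using spread_nonneg by simp
  next
    case (2 i)
    then show ?thesis
      using avoid[OF 2(1)] X_entry[OF y 2(1)] k(2) spread_nonneg[of x]
      by (cases "threshold k < d $ i") auto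
  qed
  ultimately show thesis using that k(1) by blast
qed

section \<open>The kept candidates form a smallest cover\<close>

lemma candidates_cover: "covers_all_sizes n X c0 d (candidate ` kept)"
  unfolding covers_all_sizes_def
proof (intro conjI allI impI)
  show "candidate ` kept \<subseteq> X" using candidate_in by blast
next
  fix l :: real assume l: "0 \<le> l"
  obtain k where k: "k \<in> kept" and opt: "\<And>j. j < Suc n \<Longrightarrow>
      cost (candidate k) + l * spread (candidate k) \<le> cost (candidate j) + l * spread (candidate j)"
    using selected_covers[OF l, of "Suc n" "cost \<circ> candidate" "spread \<circ> candidate"] by auto
  \<comment> \<open>Optimality among the candidates extends to \<open>X\<close>: some candidate is
    at least as good as \<open>y\<close> in both cost and spread, and \<open>l\<close> is
    nonnegative.\<close>
  have "cost (candidate k) + l * spread (candidate k) \<le> cost y + l * spread y" if y: "y \<in> X" for y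
  proof -
    obtain j where j: "j < Suc n" "cost (candidate j) \<le> cost y" "spread (candidate j) \<le> spread y"
      using candidate_dominates[OF y] .
    then show ?thesis
      using opt[OF j(1)] mult_left_mono[OF j(3) l] by linarith
  qed
  then have "robust_optimal n X c0 d l (candidate k)"
    using candidate_in by (simp add: robust_optimal_iff[OF l])
  with k show "\<exists>x\<in>candidate ` kept. robust_optimal n X c0 d l x" by blast
qed

text \<open>A kept candidate has a size at which every optimal solution has its spread, so any cover contains
  a solution of that spread.\<close>

lemma spread_kept_subset:
  assumes "covers_all_sizes n X c0 d S"
  shows "spread ` candidate ` kept \<subseteq> spread ` S"
proof -
  have "spread (candidate k) \<in> spread ` S" if k: "k \<in> kept" for k
  proof -
    obtain l where l: "0 < l"
      and strict: "\<And>j. j < Suc n \<Longrightarrow> cost (candidate j) + l * spread (candidate j)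
        \<le> cost (candidate k) + l * spread (candidate k) \<Longrightarrow>
        spread (candidate j) = spread (candidate k)"
      using selected_strictly_optimal[OF k] by auto
    obtain x where x: "x \<in> S" "robust_optimal n X c0 d l x"
      using assms l unfolding covers_all_sizes_def by (meson less_imp_le)
    then have xX: "x \<in> X"
      and opt: "\<And>y. y \<in> X \<Longrightarrow> cost x + l * spread x \<le> cost y + l * spread y"
      using robust_optimal_iff[of l x] l by auto
    \<comment> \<open>The solution \<open>x\<close> need not be a candidate, so a dominating
      candidate stands in for it. Optimality of \<open>x\<close> and \<open>0 < l\<close> force the
      two spreads to agree.\<close>
    obtain j where j: "j < Suc n" "cost (candidate j) \<le> cost x" "spread (candidate j) \<le> spread x"
      using candidate_dominates[OF xX] .
    have "cost x + l * spread x \<le> cost (candidate j) + l * spread (candidate j)"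
      by (rule opt[OF candidate_in])
    with j(2) have "l * spread x \<le> l * spread (candidate j)" by linarith
    with l j(3) have eq: "spread (candidate j) = spread x" by auto
    have "cost x + l * spread x \<le> cost (candidate k) + l * spread (candidate k)"
      by (rule opt[OF candidate_in])
    with strict[OF j(1)] eq j(2) have "spread x = spread (candidate k)" by auto
    with x(1) show ?thesis by (metis imageI)
  qed
  then show ?thesis by blast
qed

lemma inj_on_spread: "inj_on spread (candidate ` kept)"
  using inj_on_selected[of "spread \<circ> candidate" "cost \<circ> candidate" "Suc n"]
  by (rule inj_on_imageI)

text \<open>Kept candidates are counted by their spreads, which are distinct and all occur in
  \<open>S\<close>.\<close>

lemma card_kept_le:
  assumes "covers_all_sizes n X c0 d S"
  shows "card (candidate ` kept) \<le> card S"
proof -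
  have fin: "finite S"
    using assms finite_X finite_subset by (auto simp: covers_all_sizes_def)
  have "card (candidate ` kept) = card (spread ` candidate ` kept)"
    using inj_on_spread by (simp add: card_image)
  also have "\<dots> \<le> card (spread ` S)"
    using fin spread_kept_subset[OF assms] by (intro card_mono) auto
  also have "\<dots> \<le> card S" using fin by (rule card_image_le)
  finally show ?thesis .
qed

lemma candidates_solution: "variable_sized_solution n X c0 d (candidate ` kept)"
  using candidates_cover card_kept_le
  by (auto simp: variable_sized_solution_def is_arg_min_def not_less[symmetric])

text \<open>There are at most \<open>n\<close> positive values of \<open>spread\<close>; the value 0 is taken only by the zero vector,
  which is optimal for every size as soon as it is feasible.\<close>

lemma card_candidates: "card (candidate ` kept) \<le> n"
proof (cases "0\<^sub>v n \<in> X")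
  case True
  have cost_nonneg: "0 \<le> cost y" if "y \<in> X" for y
    unfolding cost_def using c0_nonneg X_entry_nonneg[OF that] by (intro sum_nonneg) auto
  have "spread (0\<^sub>v n) = 0"
    by (cases rule: spread_cases[of "0\<^sub>v n"]) auto
  moreover have "cost (0\<^sub>v n) = 0" by (simp add: cost_def)
  ultimately have "covers_all_sizes n X c0 d {0\<^sub>v n}"
    using True cost_nonneg spread_nonneg
    by (auto simp: covers_all_sizes_def robust_optimal_iff)
  \<comment> \<open>The zero vector alone is a cover, so at most one candidate is kept.\<close>
  from card_kept_le[OF this] show ?thesis using n_pos by simp
next
  case False
  have "spread x \<in> (\<lambda>i. d $ i) ` {..<n}" if x: "x \<in> X" for x
  proof -
    have "x \<noteq> 0\<^sub>v n" using False x by auto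
    then obtain i where i: "i < n" "x $ i \<noteq> 0"
      using X_carrier[OF x] by (metis eq_vecI carrier_vecD index_zero_vec)
    with X_entry[OF x i(1)] d_pos[OF i(1)] spread_ge[OF i(1), of x] have "0 < spread x" by auto
    then show ?thesis
      using X_entry[OF x] by (cases rule: spread_cases[of x]) force+
  qed
  then have "spread ` candidate ` kept \<subseteq> (\<lambda>i. d $ i) ` {..<n}"
    using candidate_in by blast
  then have "card (spread ` candidate ` kept) \<le> card ((\<lambda>i. d $ i) ` {..<n})"
    by (intro card_mono) auto
  also have "\<dots> \<le> n" using card_image_le[of "{..<n}" "\<lambda>i. d $ i"] by simp
  finally show ?thesis using inj_on_spread by (simp add: card_image)
qed

end

section \<open>Reasoning about programs\<close>

fun iwrites :: "com \<Rightarrow> string set" where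
  "iwrites (IAssign a e f) = {a}"
| "iwrites (Seq p q) = iwrites p \<union> iwrites q"
| "iwrites (Cond b p q) = iwrites p \<union> iwrites q"
| "iwrites (While b p) = iwrites p"
| "iwrites _ = {}"

fun rwrites :: "com \<Rightarrow> string set" where
  "rwrites (RAssign a e f) = {a}"
| "rwrites (Solve q a) = {a}"
| "rwrites (Seq p q) = rwrites p \<union> rwrites q"
| "rwrites (Cond b p q) = rwrites p \<union> rwrites q"
| "rwrites (While b p) = rwrites p"
| "rwrites _ = {}"

text \<open>A frame condition: \<open>A\<close> and \<open>B\<close> name the natural and the real
  arrays that may have changed.\<close>

definition agree :: "string set \<Rightarrow> string set \<Rightarrow> state \<Rightarrow> state \<Rightarrow> bool" where
  "agree A B s s' \<longleftrightarrow>
     (\<forall>a. a \<notin> A \<longrightarrow> imem s' a = imem s a) \<and> (\<forall>a. a \<notin> B \<longrightarrow> rmem s' a = rmem s a)"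

lemma mem_upd [simp]:
  "imem (iupd a j v s) b = (if b = a then (imem s a)(j := v) else imem s b)"
  "rmem (iupd a j v s) = rmem s"
  "imem (rupd a j w s) = imem s"
  "rmem (rupd a j w s) b = (if b = a then (rmem s a)(j := w) else rmem s b)"
  "imem (rupd_vec a n x s) = imem s"
  "rmem (rupd_vec a n x s) b =
     (if b = a then (\<lambda>i. if i < n then x $ i else rmem s a i) else rmem s b)"
  by (auto simp: iupd_def rupd_def rupd_vec_def)

lemma exec_agree: "exec n sol T p s t s' \<Longrightarrow> agree (iwrites p) (rwrites p) s s'"
  by (induction rule: exec.induct) (auto simp: agree_def)

text \<open>Total correctness with a time bound. An upper bound in place of the exact time lets
  branches of different length share one figure.\<close>

definition runs ::
  "nat \<Rightarrow> (real vec \<Rightarrow> real vec) \<Rightarrow> nat \<Rightarrow> com \<Rightarrow> state \<Rightarrow> nat \<Rightarrow> (state \<Rightarrow> bool) \<Rightarrow> bool" where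
  "runs n sol T p s t P \<longleftrightarrow> (\<exists>t' s'. exec n sol T p s t' s' \<and> t' \<le> t \<and> P s')"

lemma runs_weaken:
  "runs n sol T p s t P \<Longrightarrow> t \<le> u \<Longrightarrow> (\<And>s'. P s' \<Longrightarrow> Q s') \<Longrightarrow> runs n sol T p s u Q"
  unfolding runs_def by (meson order_trans)

lemma runs_Skip [simp]: "runs n sol T Skip s t P \<longleftrightarrow> 1 \<le> t \<and> P s"
  unfolding runs_def by (auto elim!: exec_elims intro: exec.Skip[unfolded One_nat_def])

lemma runs_IAssign [simp]:
  "runs n sol T (IAssign a e f) s t P \<longleftrightarrow> 1 \<le> t \<and> P (iupd a (ival e s) (ival f s) s)"
  unfolding runs_def by (auto elim!: exec_elims intro: exec.IAssign[unfolded One_nat_def])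

lemma runs_RAssign [simp]:
  "runs n sol T (RAssign a e f) s t P \<longleftrightarrow> 1 \<le> t \<and> P (rupd a (ival e s) (rval f s) s)"
  unfolding runs_def by (auto elim!: exec_elims intro: exec.RAssign[unfolded One_nat_def])

lemma runs_Solve [simp]:
  "runs n sol T (Solve q a) s t P \<longleftrightarrow>
     T \<le> t \<and> P (rupd_vec a n (sol (vec n (rmem s q))) s)"
  unfolding runs_def by (auto elim!: exec_elims intro: exec.intros)

lemma runs_Cond [simp]:
  "runs n sol T (Cond b p q) s t P \<longleftrightarrow>
     1 \<le> t \<and> runs n sol T (if bval b s then p else q) s (t - 1) P"
proof
  assume "runs n sol T (Cond b p q) s t P"
  then obtain t' s' where "exec n sol T (Cond b p q) s t' s'" "t' \<le> t" "P s'"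
    by (auto simp: runs_def)
  then show "1 \<le> t \<and> runs n sol T (if bval b s then p else q) s (t - 1) P"
    by (elim exec_elims) (auto simp: runs_def intro!: exI)
next
  assume r: "1 \<le> t \<and> runs n sol T (if bval b s then p else q) s (t - 1) P"
  then obtain t' s' where "exec n sol T (if bval b s then p else q) s t' s'" "t' \<le> t - 1" "P s'"
    by (auto simp: runs_def)
  with r show "runs n sol T (Cond b p q) s t P"
    unfolding runs_def
    by (intro exI[of _ "1 + t'"] exI[of _ s'])
      (auto intro: exec.CondTrue[simplified] exec.CondFalse[simplified] split: if_splits)
qed

text \<open>Passing the frame condition to the second program keeps intermediate assertions down to
  what the first one computes.\<close>

lemma runs_Seq:
  assumes "runs n sol T p s t P"
    and "\<And>s'. P s' \<Longrightarrow> agree (iwrites p) (rwrites p) s s' \<Longrightarrow> runs n sol T q s' u Q"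
    and "t + u \<le> v"
  shows "runs n sol T (Seq p q) s v Q"
proof -
  obtain t' s' where p: "exec n sol T p s t' s'" "t' \<le> t" "P s'"
    using assms(1) by (auto simp: runs_def)
  with assms(2) exec_agree obtain u' s'' where "exec n sol T q s' u' s''" "u' \<le> u" "Q s''"
    unfolding runs_def by blast
  with p assms(3) show ?thesis
    unfolding runs_def by (intro exI[of _ "t' + u'"] exI[of _ s'']) (auto intro: exec.Seq)
qed

lemma runs_Seq_IAssign [simp]:
  "1 \<le> t \<Longrightarrow> runs n sol T q (iupd a (ival e s) (ival f s) s) (t - 1) Q \<Longrightarrow>
     runs n sol T (Seq (IAssign a e f) q) s t Q"
  by (rule runs_Seq[where t = 1 and u = "t - 1" and P = "\<lambda>s'. s' = iupd a (ival e s) (ival f s) s"])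
    auto

lemma runs_Seq_RAssign [simp]:
  "1 \<le> t \<Longrightarrow> runs n sol T q (rupd a (ival e s) (rval f s) s) (t - 1) Q \<Longrightarrow>
     runs n sol T (Seq (RAssign a e f) q) s t Q"
  by (rule runs_Seq[where t = 1 and u = "t - 1" and P = "\<lambda>s'. s' = rupd a (ival e s) (rval f s) s"])
    auto

abbreviation ivar :: "string \<Rightarrow> iexp" where "ivar a \<equiv> IGet a (INum 0)"

abbreviation rvar :: "string \<Rightarrow> rexp" where "rvar a \<equiv> RGet a (INum 0)"

abbreviation Disj :: "bexp \<Rightarrow> bexp \<Rightarrow> bexp" where "Disj b c \<equiv> Neg (Conj (Neg b) (Neg c))"

definition For :: "string \<Rightarrow> iexp \<Rightarrow> com \<Rightarrow> com" where
  "For i e p = Seq (IAssign i (INum 0) (INum 0))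
     (While (ILess (ivar i) e) (Seq p (IAssign i (INum 0) (IAdd (ivar i) (INum 1)))))"

lemma writes_For [simp]:
  "iwrites (For i e p) = insert i (iwrites p)" "rwrites (For i e p) = rwrites p"
  by (auto simp: For_def)

text \<open>The bound \<open>e\<close> is evaluated anew at each test, hence must survive the body;
  \<open>indep\<close> lets the invariant survive the increment. Each round pays for the body, a
  test and an increment; the final 2 is the initial assignment and the failing test.\<close>

lemma runs_For:
  assumes bound: "\<And>s'. agree (insert i (iwrites p)) (rwrites p) s s' \<Longrightarrow> ival e s' = N"
    and fresh: "i \<notin> iwrites p"
    and indep: "\<And>j v s'. I j s' \<Longrightarrow> I j (iupd i 0 v s')"
    and init: "I 0 s"
    and step: "\<And>j s'. j < N \<Longrightarrow> I j s' \<Longrightarrow> imem s' i 0 = j \<Longrightarrow>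
      agree (insert i (iwrites p)) (rwrites p) s s' \<Longrightarrow> runs n sol T p s' t (I (Suc j))"
    and time: "N * (t + 2) + 2 \<le> u"
    and post: "\<And>s'. I N s' \<Longrightarrow> agree (insert i (iwrites p)) (rwrites p) s s' \<Longrightarrow> Q s'"
  shows "runs n sol T (For i e p) s u Q"
proof -
  let ?body = "Seq p (IAssign i (INum 0) (IAdd (ivar i) (INum 1)))"
  let ?agree = "agree (insert i (iwrites p)) (rwrites p)"
  have loop: "runs n sol T (While (ILess (ivar i) e) ?body) s' ((N - j) * (t + 2) + 1) Q"
    if "j \<le> N" "I j s'" "imem s' i 0 = j" "?agree s s'" for j s'
    using that
  \<comment> \<open>Induction on the number of remaining rounds.\<close>
  proof (induction "N - j" arbitrary: j s')
    case 0
    then have "\<not> bval (ILess (ivar i) e) s'" and "Q s'"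
      using bound post by auto
    then show ?case
      unfolding runs_def
      by (intro exI[of _ 1] exI[of _ s']) (auto intro!: exec.WhileFalse[simplified])
  next
    case (Suc m)
    then have j: "j < N" by simp
    obtain t' s1 where s1: "exec n sol T p s' t' s1" "t' \<le> t" "I (Suc j) s1"
      using step[OF j Suc.prems(2-4)] by (auto simp: runs_def)
    let ?s2 = "iupd i 0 (Suc j) s1"
    have agree1: "agree (iwrites p) (rwrites p) s' s1"
      using exec_agree[OF s1(1)] .
    then have "imem s1 i 0 = j"
      using fresh Suc.prems(3) by (auto simp: agree_def)
    then have body: "exec n sol T ?body s' (t' + 1) ?s2"
      using exec.Seq[OF s1(1) exec.IAssign, of i "INum 0" "IAdd (ivar i) (INum 1)"] by simp
    have "?agree s ?s2"
      using Suc.prems(4) agree1 by (auto simp: agree_def)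
    then have "runs n sol T (While (ILess (ivar i) e) ?body) ?s2 ((N - Suc j) * (t + 2) + 1) Q"
      using Suc.hyps(2) j indep[OF s1(3)] by (intro Suc.hyps(1)) auto
    then obtain u' s'' where rest: "exec n sol T (While (ILess (ivar i) e) ?body) ?s2 u' s''"
      "u' \<le> (N - Suc j) * (t + 2) + 1" "Q s''"
      by (auto simp: runs_def)
    have "bval (ILess (ivar i) e) s'"
      using bound[OF Suc.prems(4)] Suc.prems(3) j by simp
    from exec.WhileTrue[OF this body rest(1)]
    have "exec n sol T (While (ILess (ivar i) e) ?body) s' (1 + (t' + 1) + u') s''" .
    moreover have "N - j = Suc (N - Suc j)" using j by simp
    then have "1 + (t' + 1) + u' \<le> (N - j) * (t + 2) + 1"
      using s1(2) rest(2) by simp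
    ultimately show ?case using rest(3) unfolding runs_def by blast
  qed
  show ?thesis
    unfolding For_def
  proof (rule runs_Seq_IAssign)
    show "1 \<le> u" using time by simp
    have "runs n sol T (While (ILess (ivar i) e) ?body) (iupd i 0 0 s) ((N - 0) * (t + 2) + 1) Q"
      by (rule loop) (auto simp: agree_def intro: indep init)
    then have "runs n sol T (While (ILess (ivar i) e) ?body) (iupd i 0 0 s) (u - 1) Q"
      by (rule runs_weaken) (use time in auto)
    then show "runs n sol T (While (ILess (ivar i) e) ?body)
        (iupd i (ival (INum 0) s) (ival (INum 0) s) s) (u - 1) Q"
      by simp
  qed
qed


section \<open>The algorithm\<close>

definition penalty_com :: com where
  "penalty_com = Seq (RAssign ''M'' (INum 0) (RNum 1))
     (For ''i'' (ivar ''n'')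
       (RAssign ''M'' (INum 0) (RAdd (rvar ''M'') (RGet ''c'' (ivar ''i'')))))"

definition query_com :: com where
  "query_com = Seq
     (For ''i'' (ivar ''n'')
       (Cond (RLess (RGet ''d'' (ivar ''k'')) (RGet ''d'' (ivar ''i'')))
         (RAssign ''q'' (ivar ''i'') (rvar ''M''))
         (RAssign ''q'' (ivar ''i'') (RGet ''c'' (ivar ''i'')))))
     (Solve ''q'' ''x'')"

definition evaluate_com :: com where
  "evaluate_com = Seq (RAssign ''f'' (ivar ''k'') (RNum 0)) (Seq (RAssign ''g'' (ivar ''k'') (RNum 0))
     (For ''i'' (ivar ''n'')
       (Seq (RAssign ''f'' (ivar ''k'') (RAdd (RGet ''f'' (ivar ''k''))
              (RMul (RGet ''c'' (ivar ''i'')) (RGet ''x'' (ivar ''i'')))))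
         (Cond (RLess (RGet ''g'' (ivar ''k'')) (RMul (RGet ''d'' (ivar ''i'')) (RGet ''x'' (ivar ''i''))))
           (RAssign ''g'' (ivar ''k'') (RMul (RGet ''d'' (ivar ''i'')) (RGet ''x'' (ivar ''i''))))
           Skip))))"

definition survey_com :: com where
  "survey_com = For ''k'' (IAdd (ivar ''n'') (INum 1)) (Seq query_com evaluate_com)"

text \<open>In \<open>slope_com\<close> this is evaluated even for a zero denominator, for example
  at \<open>j = k\<close>; the first conjunct of the test is false then.\<close>

definition quotient_exp :: rexp where
  "quotient_exp = RDiv (RSub (RGet ''f'' (ivar ''k'')) (RGet ''f'' (ivar ''j'')))
     (RSub (RGet ''g'' (ivar ''j'')) (RGet ''g'' (ivar ''k'')))"

definition slope_com :: com where
  "slope_com = Seq (RAssign ''L'' (INum 0) (RNum 0))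
     (For ''j'' (IAdd (ivar ''n'') (INum 1))
       (Cond (Conj (RLess (RGet ''g'' (ivar ''k'')) (RGet ''g'' (ivar ''j'')))
           (RLess (rvar ''L'') quotient_exp))
         (RAssign ''L'' (INum 0) quotient_exp)
         Skip))"

definition line_exp :: "string \<Rightarrow> rexp" where
  "line_exp a = RAdd (RGet ''f'' (ivar a)) (RMul (rvar ''L'') (RGet ''g'' (ivar a)))"

definition beats_exp :: bexp where
  "beats_exp = Disj (RLess (line_exp ''j'') (line_exp ''k''))
     (Conj (Neg (RLess (line_exp ''k'') (line_exp ''j'')))
       (Disj (RLess (RGet ''g'' (ivar ''j'')) (RGet ''g'' (ivar ''k'')))
         (Conj (Neg (RLess (RGet ''g'' (ivar ''k'')) (RGet ''g'' (ivar ''j''))))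
           (ILess (ivar ''j'') (ivar ''k'')))))"

definition test_com :: com where
  "test_com = Seq (IAssign ''z'' (INum 0) (INum 1))
     (For ''j'' (IAdd (ivar ''n'') (INum 1))
       (Cond beats_exp (IAssign ''z'' (INum 0) (INum 0)) Skip))"

definition copy_com :: com where
  "copy_com = For ''i'' (ivar ''n'')
     (RAssign ''S'' (IAdd (ivar ''b'') (ivar ''i'')) (RGet ''x'' (ivar ''i'')))"

text \<open>Only cost and spread of the candidates are stored, so a kept candidate is computed a
  second time. The scalar \<open>b\<close> holds the offset of the next row; it is advanced by
  addition because addresses cannot be multiplied.\<close>

definition emit_com :: com where
  "emit_com = Seq query_com (Seq copy_com
     (Seq (IAssign ''m'' (INum 0) (IAdd (ivar ''m'') (INum 1)))
       (IAssign ''b'' (INum 0) (IAdd (ivar ''b'') (ivar ''n'')))))"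

definition select_com :: com where
  "select_com = For ''k'' (IAdd (ivar ''n'') (INum 1))
     (Seq slope_com (Seq test_com (Cond (ILess (INum 0) (ivar ''z'')) emit_com Skip)))"

definition main_com :: com where
  "main_com = Seq penalty_com (Seq survey_com select_com)"

lemma writes_com [simp]:
  "iwrites penalty_com = {''i''}" "rwrites penalty_com = {''M''}"
  "iwrites query_com = {''i''}" "rwrites query_com = {''q'', ''x''}"
  "iwrites evaluate_com = {''i''}" "rwrites evaluate_com = {''f'', ''g''}"
  "iwrites survey_com = {''i'', ''k''}" "rwrites survey_com = {''q'', ''x'', ''f'', ''g''}"
  "iwrites slope_com = {''j''}" "rwrites slope_com = {''L''}"
  "iwrites test_com = {''j'', ''z''}" "rwrites test_com = {}"
  "iwrites copy_com = {''i''}" "rwrites copy_com = {''S''}"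
  "iwrites emit_com = {''i'', ''m'', ''b''}" "rwrites emit_com = {''q'', ''x'', ''S''}"
  by (auto simp: penalty_com_def query_com_def evaluate_com_def survey_com_def slope_com_def
    test_com_def copy_com_def emit_com_def)

section \<open>Rows of the output array\<close>

lemma output_set_cong:
  "imem s ''m'' = imem s' ''m'' \<Longrightarrow> rmem s ''S'' = rmem s' ''S'' \<Longrightarrow> output_set n s = output_set n s'"
  by (simp add: output_set_def)

lemma output_set_insert_row:
  assumes "imem s' ''m'' 0 = Suc (imem s ''m'' 0)"
    and "\<And>p. p < imem s ''m'' 0 * n \<Longrightarrow> rmem s' ''S'' p = rmem s ''S'' p"
    and "\<And>i. i < n \<Longrightarrow> rmem s' ''S'' (imem s ''m'' 0 * n + i) = y $ i"
    and "y \<in> carrier_vec n"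
  shows "output_set n s' = insert y (output_set n s)"
proof -
  let ?row = "\<lambda>s j. vec n (\<lambda>i. rmem s ''S'' (j * n + i))"
  have rows: "output_set n s = ?row s ` {..<imem s ''m'' 0}" for s
    by (auto simp: output_set_def)
  have "?row s' j = ?row s j" if "j < imem s ''m'' 0" for j
  proof (rule eq_vecI)
    fix i assume "i < dim_vec (?row s j)"
    moreover have "j * n + i < imem s ''m'' 0 * n" if "i < n"
    proof -
      \<comment> \<open>Row \<open>j\<close> ends where row \<open>Suc j\<close> starts, so the old
        rows lie below the cells of the new one.\<close>
      have "j * n + i < Suc j * n" using that by simp
      also have "\<dots> \<le> imem s ''m'' 0 * n"
        using \<open>j < imem s ''m'' 0\<close> by (intro mult_le_mono1) simp
      finally show ?thesis .
    qed
    ultimately show "?row s' j $ i = ?row s j $ i"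
      using assms(2) by simp
  qed simp
  moreover have "?row s' (imem s ''m'' 0) = y"
    using assms(3,4) by (intro eq_vecI) auto
  ultimately show ?thesis
    unfolding rows assms(1) lessThan_Suc image_insert
    by (metis (no_types, lifting) image_cong lessThan_iff)
qed

section \<open>Correctness and running time of the phases\<close>

context robust_instance
begin

text \<open>Array \<open>d\<close> is described beyond its first \<open>n\<close> cells because
  \<open>query_com\<close> reads cell \<open>n\<close> as the threshold 0.\<close>

definition loaded :: "state \<Rightarrow> bool" where
  "loaded s \<longleftrightarrow> imem s ''n'' 0 = n \<and> (\<forall>i. rmem s ''d'' i = threshold i) \<and>
     (\<forall>i<n. rmem s ''c'' i = c0 $ i)"

definition ready :: "state \<Rightarrow> bool" where
  "ready s \<longleftrightarrow> loaded s \<and> rmem s ''M'' 0 = penalty"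

definition surveyed :: "state \<Rightarrow> bool" where
  "surveyed s \<longleftrightarrow> (\<forall>j<Suc n. rmem s ''f'' j = cost (candidate j) \<and>
     rmem s ''g'' j = spread (candidate j))"

lemma loaded_input_state: "loaded (input_state n c0 d)"
  by (auto simp: loaded_def input_state_def threshold_def)

lemma loaded_agree:
  "loaded s \<Longrightarrow> agree A B s s' \<Longrightarrow> ''n'' \<notin> A \<Longrightarrow> ''d'' \<notin> B \<Longrightarrow> ''c'' \<notin> B \<Longrightarrow> loaded s'"
  by (simp add: loaded_def agree_def)

lemma ready_agree:
  "ready s \<Longrightarrow> agree A B s s' \<Longrightarrow> ''n'' \<notin> A \<Longrightarrow> ''d'' \<notin> B \<Longrightarrow> ''c'' \<notin> B \<Longrightarrow> ''M'' \<notin> B \<Longrightarrow> ready s'"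
  using loaded_agree[of s A B s'] by (simp add: ready_def agree_def)

lemma surveyed_agree:
  "surveyed s \<Longrightarrow> agree A B s s' \<Longrightarrow> ''f'' \<notin> B \<Longrightarrow> ''g'' \<notin> B \<Longrightarrow> surveyed s'"
  by (simp add: surveyed_def agree_def)

text \<open>Each of the \<open>n\<close> rounds takes one assignment and two steps of loop control;
  starting and leaving the loop takes two steps, the first assignment one. Later bounds arise in the
  same way.\<close>

lemma runs_penalty:
  assumes s: "loaded s"
  shows "runs n sol T penalty_com s (3 * n + 3) (\<lambda>s'. rmem s' ''M'' 0 = penalty)"
  unfolding penalty_com_def
proof (rule runs_Seq_RAssign)
  let ?s = "rupd ''M'' (ival (INum 0) s) (rval (RNum 1) s) s"
  show "runs n sol T (For ''i'' (ivar ''n'')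
      (RAssign ''M'' (INum 0) (RAdd (rvar ''M'') (RGet ''c'' (ivar ''i'')))))
      ?s (3 * n + 3 - 1) (\<lambda>s'. rmem s' ''M'' 0 = penalty)"
    by (rule runs_For[where N = n and t = 1 and I = "\<lambda>j s'. rmem s' ''M'' 0 = 1 + (\<Sum>i<j. c0 $ i)"])
      (use s in \<open>auto simp: loaded_def agree_def penalty_def\<close>)
qed simp

lemma runs_query:
  assumes s: "ready s"
  shows "runs n sol T query_com s (4 * n + 2 + T)
    (\<lambda>s'. \<forall>i<n. rmem s' ''x'' i = candidate (imem s ''k'' 0) $ i)"
  unfolding query_com_def
proof (rule runs_Seq)
  let ?k = "imem s ''k'' 0"
  show "runs n sol T (For ''i'' (ivar ''n'')
       (Cond (RLess (RGet ''d'' (ivar ''k'')) (RGet ''d'' (ivar ''i'')))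
         (RAssign ''q'' (ivar ''i'') (rvar ''M''))
         (RAssign ''q'' (ivar ''i'') (RGet ''c'' (ivar ''i'')))))
       s (4 * n + 2) (\<lambda>s'. \<forall>i<n. rmem s' ''q'' i = query ?k $ i)"
    by (rule runs_For[where N = n and t = 2 and I = "\<lambda>j s'. \<forall>i<j. rmem s' ''q'' i = query ?k $ i"])
      (use s in \<open>auto simp: ready_def loaded_def agree_def query_def threshold_def less_Suc_eq\<close>)
next
  fix s' :: state assume "\<forall>i<n. rmem s' ''q'' i = query (imem s ''k'' 0) $ i"
  then have "vec n (rmem s' ''q'') = query (imem s ''k'' 0)"
    by (intro eq_vecI) (auto simp: query_def)
  then show "runs n sol T (Solve ''q'' ''x'') s' T
      (\<lambda>s'. \<forall>i<n. rmem s' ''x'' i = candidate (imem s ''k'' 0) $ i)"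
    by (simp add: candidate_def)
qed simp

text \<open>The result is stated for whole arrays, so that the values of earlier candidates are seen
  to survive.\<close>

lemma runs_evaluate:
  assumes s: "loaded s" and x: "\<forall>i<n. rmem s ''x'' i = y $ i"
  shows "runs n sol T evaluate_com s (5 * n + 4)
    (\<lambda>s'. rmem s' ''f'' = (rmem s ''f'')(imem s ''k'' 0 := cost y) \<and>
       rmem s' ''g'' = (rmem s ''g'')(imem s ''k'' 0 := spread y))"
proof -
  define k where "k = imem s ''k'' 0"
  \<comment> \<open>The maximum over the first \<open>j\<close> items: the loop invariant that ends
    in \<open>spread y\<close>.\<close>
  define G where "G j = Max (insert 0 ((\<lambda>i. d $ i * y $ i) ` {..<j}))" for j
  have G_Suc: "G (Suc j) = max (G j) (d $ j * y $ j)" for j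
    unfolding G_def lessThan_Suc by (simp add: insert_commute[of 0] max.commute)
  let ?s = "rupd ''g'' k 0 (rupd ''f'' k 0 s)"
  have "runs n sol T (For ''i'' (ivar ''n'')
       (Seq (RAssign ''f'' (ivar ''k'') (RAdd (RGet ''f'' (ivar ''k''))
              (RMul (RGet ''c'' (ivar ''i'')) (RGet ''x'' (ivar ''i'')))))
         (Cond (RLess (RGet ''g'' (ivar ''k'')) (RMul (RGet ''d'' (ivar ''i'')) (RGet ''x'' (ivar ''i''))))
           (RAssign ''g'' (ivar ''k'') (RMul (RGet ''d'' (ivar ''i'')) (RGet ''x'' (ivar ''i''))))
           Skip))) ?s (5 * n + 2)
       (\<lambda>s'. rmem s' ''f'' = (rmem s ''f'')(k := cost y) \<and>
          rmem s' ''g'' = (rmem s ''g'')(k := spread y))"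
  proof (rule runs_For[where N = n and t = 3 and I = "\<lambda>j s'.
      rmem s' ''f'' = (rmem s ''f'')(k := \<Sum>i<j. c0 $ i * y $ i) \<and>
      rmem s' ''g'' = (rmem s ''g'')(k := G j)"], goal_cases)
    case (5 j s')
    then have "imem s' ''k'' 0 = k" "rmem s' ''c'' j = c0 $ j" "rmem s' ''d'' j = d $ j"
      "rmem s' ''x'' j = y $ j"
      using s x by (auto simp: loaded_def agree_def k_def threshold_def)
    with 5 show ?case by (auto simp: G_Suc)
  qed (use s in \<open>auto simp: loaded_def agree_def cost_def spread_def G_def\<close>)
  then show ?thesis
    unfolding evaluate_com_def
    by (intro runs_Seq_RAssign) (auto simp: k_def)
qed

lemma runs_survey:
  assumes s: "ready s"
  shows "runs n sol T survey_com s (Suc n * (9 * n + 8 + T) + 2) surveyed"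
  unfolding survey_com_def
proof (rule runs_For[where N = "Suc n" and t = "9 * n + 6 + T" and I = "\<lambda>k s'. \<forall>j<k.
    rmem s' ''f'' j = cost (candidate j) \<and> rmem s' ''g'' j = spread (candidate j)"], goal_cases)
  case (5 k s1)
  then have ready1: "ready s1" using s by (auto elim: ready_agree)
  show ?case
  proof (rule runs_Seq[OF runs_query[OF ready1]])
    fix s2
    assume s2: "\<forall>i<n. rmem s2 ''x'' i = candidate (imem s1 ''k'' 0) $ i"
      "agree (iwrites query_com) (rwrites query_com) s1 s2"
    then have "loaded s2" using ready1 by (auto simp: ready_def elim: loaded_agree)
    from runs_evaluate[OF this s2(1)]
    show "runs n sol T evaluate_com s2 (5 * n + 4) (\<lambda>s'. \<forall>j<Suc k.
        rmem s' ''f'' j = cost (candidate j) \<and> rmem s' ''g'' j = spread (candidate j))"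
      by (rule runs_weaken) (use s2(2) 5 in \<open>auto simp: agree_def less_Suc_eq\<close>)
  qed simp
qed (use s in \<open>auto simp: ready_def loaded_def agree_def surveyed_def\<close>)

lemma runs_slope:
  assumes s: "loaded s" "surveyed s" and k: "imem s ''k'' 0 = k" "k < Suc n"
  shows "runs n sol T slope_com s (4 * n + 7)
    (\<lambda>s'. rmem s' ''L'' 0 = slope (cost \<circ> candidate) (spread \<circ> candidate) (Suc n) k)"
  unfolding slope_com_def
proof (rule runs_Seq_RAssign)
  let ?s = "rupd ''L'' (ival (INum 0) s) (rval (RNum 0) s) s"
  show "runs n sol T (For ''j'' (IAdd (ivar ''n'') (INum 1))
       (Cond (Conj (RLess (RGet ''g'' (ivar ''k'')) (RGet ''g'' (ivar ''j'')))
           (RLess (rvar ''L'') quotient_exp))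
         (RAssign ''L'' (INum 0) quotient_exp)
         Skip)) ?s (4 * n + 7 - 1)
      (\<lambda>s'. rmem s' ''L'' 0 = slope (cost \<circ> candidate) (spread \<circ> candidate) (Suc n) k)"
  proof (rule runs_For[where N = "Suc n" and t = 2 and I = "\<lambda>j s'. rmem s' ''L'' 0 =
      slope (cost \<circ> candidate) (spread \<circ> candidate) j k"], goal_cases)
    case (5 j s')
    then have "rmem s' ''f'' j = cost (candidate j)" "rmem s' ''g'' j = spread (candidate j)"
      "rmem s' ''f'' k = cost (candidate k)" "rmem s' ''g'' k = spread (candidate k)"
      "imem s' ''k'' 0 = k"
      using s k by (auto simp: agree_def surveyed_def)
    with 5 show ?case by (auto simp: slope_Suc quotient_exp_def)
  qed (use s in \<open>auto simp: loaded_def agree_def\<close>)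
qed simp

lemma runs_test:
  assumes s: "loaded s" "surveyed s" and k: "imem s ''k'' 0 = k" "k < Suc n"
    and L: "rmem s ''L'' 0 = slope (cost \<circ> candidate) (spread \<circ> candidate) (Suc n) k"
  shows "runs n sol T test_com s (4 * n + 7) (\<lambda>s'. 0 < imem s' ''z'' 0 \<longleftrightarrow> k \<in> kept)"
  unfolding test_com_def
proof (rule runs_Seq_IAssign)
  let ?s = "iupd ''z'' (ival (INum 0) s) (ival (INum 1) s) s"
  show "runs n sol T (For ''j'' (IAdd (ivar ''n'') (INum 1))
       (Cond beats_exp (IAssign ''z'' (INum 0) (INum 0)) Skip)) ?s (4 * n + 7 - 1)
      (\<lambda>s'. 0 < imem s' ''z'' 0 \<longleftrightarrow> k \<in> kept)"
  \<comment> \<open>The flag \<open>z\<close> stays 1 as long as none of the first \<open>j\<close>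
    candidates beats \<open>k\<close>.\<close>
  proof (rule runs_For[where N = "Suc n" and t = 2 and I = "\<lambda>j s'. 0 < imem s' ''z'' 0 \<longleftrightarrow>
      (\<forall>i<j. \<not> beats (cost \<circ> candidate) (spread \<circ> candidate)
        (slope (cost \<circ> candidate) (spread \<circ> candidate) (Suc n) k) i k)"], goal_cases)
    case (5 j s')
    then have "rmem s' ''f'' j = cost (candidate j)" "rmem s' ''g'' j = spread (candidate j)"
      "rmem s' ''f'' k = cost (candidate k)" "rmem s' ''g'' k = spread (candidate k)"
      "imem s' ''k'' 0 = k" "rmem s' ''L'' 0 = rmem s ''L'' 0"
      using s k by (auto simp: agree_def surveyed_def)
    with 5 have "bval beats_exp s' \<longleftrightarrow> beats (cost \<circ> candidate) (spread \<circ> candidate)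
        (slope (cost \<circ> candidate) (spread \<circ> candidate) (Suc n) k) j k"
      by (auto simp: beats_exp_def line_exp_def beats_def L)
    with 5 show ?case by (auto simp: less_Suc_eq)
  qed (use s k in \<open>auto simp: loaded_def agree_def selected_def\<close>)
qed simp

lemma runs_copy:
  assumes s: "loaded s"
  shows "runs n sol T copy_com s (3 * n + 2)
    (\<lambda>s'. \<forall>p. rmem s' ''S'' p = (let b = imem s ''b'' 0 in
       if b \<le> p \<and> p < b + n then rmem s ''x'' (p - b) else rmem s ''S'' p))"
  unfolding copy_com_def
  by (rule runs_For[where N = n and t = 1 and I = "\<lambda>j s'. \<forall>p. rmem s' ''S'' p =
      (let b = imem s ''b'' 0 in
       if b \<le> p \<and> p < b + j then rmem s ''x'' (p - b) else rmem s ''S'' p)"])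
    (use s in \<open>auto simp: loaded_def agree_def Let_def\<close>)

lemma runs_emit:
  assumes s: "ready s" and b: "imem s ''b'' 0 = imem s ''m'' 0 * n"
  shows "runs n sol T emit_com s (7 * n + 6 + T)
    (\<lambda>s'. imem s' ''b'' 0 = imem s' ''m'' 0 * n \<and>
       output_set n s' = insert (candidate (imem s ''k'' 0)) (output_set n s))"
  unfolding emit_com_def
proof (rule runs_Seq[OF runs_query[OF s]])
  fix s1
  assume s1: "\<forall>i<n. rmem s1 ''x'' i = candidate (imem s ''k'' 0) $ i"
    "agree (iwrites query_com) (rwrites query_com) s s1"
  then have loaded1: "loaded s1" using s by (auto simp: ready_def elim: loaded_agree)
  show "runs n sol T (Seq copy_com
     (Seq (IAssign ''m'' (INum 0) (IAdd (ivar ''m'') (INum 1)))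
       (IAssign ''b'' (INum 0) (IAdd (ivar ''b'') (ivar ''n''))))) s1 (3 * n + 4)
    (\<lambda>s'. imem s' ''b'' 0 = imem s' ''m'' 0 * n \<and>
       output_set n s' = insert (candidate (imem s ''k'' 0)) (output_set n s))"
  proof (rule runs_Seq[OF runs_copy[OF loaded1]])
    fix s2
    assume s2: "\<forall>p. rmem s2 ''S'' p = (let b = imem s1 ''b'' 0 in
       if b \<le> p \<and> p < b + n then rmem s1 ''x'' (p - b) else rmem s1 ''S'' p)"
      "agree (iwrites copy_com) (rwrites copy_com) s1 s2"
    let ?s3 = "iupd ''m'' 0 (Suc (imem s2 ''m'' 0)) s2"
    let ?s4 = "iupd ''b'' 0 (imem s2 ''b'' 0 + imem s2 ''n'' 0) ?s3"
    have mem: "imem s2 ''m'' 0 = imem s ''m'' 0" "imem s2 ''b'' 0 = imem s ''m'' 0 * n"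
      "imem s2 ''n'' 0 = n" "imem s1 ''b'' 0 = imem s ''m'' 0 * n" "rmem s1 ''S'' = rmem s ''S''"
      using s1(2) s2(2) b loaded1 by (auto simp: agree_def loaded_def)
    have "output_set n ?s4 = insert (candidate (imem s ''k'' 0)) (output_set n s)"
      by (rule output_set_insert_row)
        (use mem s1(1) s2(1) X_carrier[OF candidate_in] in \<open>auto simp: Let_def\<close>)
    then show "runs n sol T
      (Seq (IAssign ''m'' (INum 0) (IAdd (ivar ''m'') (INum 1)))
        (IAssign ''b'' (INum 0) (IAdd (ivar ''b'') (ivar ''n'')))) s2 2
      (\<lambda>s'. imem s' ''b'' 0 = imem s' ''m'' 0 * n \<and>
        output_set n s' = insert (candidate (imem s ''k'' 0)) (output_set n s))"
      by (intro runs_Seq_IAssign) (use mem in auto)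
  qed simp
qed simp

lemma runs_select:
  assumes s: "ready s" "surveyed s" and init: "imem s ''m'' 0 = 0" "imem s ''b'' 0 = 0"
  shows "runs n sol T select_com s (Suc n * (15 * n + 23 + T) + 2)
    (\<lambda>s'. output_set n s' = candidate ` kept)"
  unfolding select_com_def
\<comment> \<open>The time of a round adds \<open>4 * n + 7\<close> for the slope,
  \<open>4 * n + 7\<close> for the test and \<open>7 * n + 7 + T\<close> for the conditional
  output.\<close>
proof (rule runs_For[where N = "Suc n" and t = "15 * n + 21 + T" and I = "\<lambda>k s'.
    imem s' ''b'' 0 = imem s' ''m'' 0 * n \<and>
    output_set n s' = candidate ` {j \<in> kept. j < k}"], goal_cases)
  case (3 k v s')
  then show ?case
    using output_set_cong[of "iupd ''k'' 0 v s'" s'] by simp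
next
  case 4
  then show ?case using init by (auto simp: output_set_def)
next
  case (5 k s1)
  have s1: "ready s1" "surveyed s1" "loaded s1"
    using 5(4) s by (auto simp: ready_def elim: loaded_agree ready_agree surveyed_agree)
      (auto simp: agree_def)
  show ?case
  proof (rule runs_Seq[OF runs_slope[OF s1(3,2) 5(3,1)]])
    fix s2
    assume s2: "rmem s2 ''L'' 0 = slope (cost \<circ> candidate) (spread \<circ> candidate) (Suc n) k"
      "agree (iwrites slope_com) (rwrites slope_com) s1 s2"
    have inv2: "ready s2" "surveyed s2" "loaded s2"
      using s2(2) s1 by (auto elim: ready_agree surveyed_agree loaded_agree)
    have k2: "imem s2 ''k'' 0 = k" using s2(2) 5(3) by (auto simp: agree_def)
    show "runs n sol T (Seq test_com (Cond (ILess (INum 0) (ivar ''z'')) emit_com Skip))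
      s2 (11 * n + 14 + T) (\<lambda>s'. imem s' ''b'' 0 = imem s' ''m'' 0 * n \<and>
        output_set n s' = candidate ` {j \<in> kept. j < Suc k})"
    proof (rule runs_Seq[OF runs_test[OF inv2(3,2) k2 5(1) s2(1)]])
      fix s3
      assume s3: "0 < imem s3 ''z'' 0 \<longleftrightarrow> k \<in> kept"
        "agree (iwrites test_com) (rwrites test_com) s2 s3"
      have ready3: "ready s3" using s3(2) inv2(1) by (auto elim: ready_agree)
      have b3: "imem s3 ''b'' 0 = imem s3 ''m'' 0 * n" and k3: "imem s3 ''k'' 0 = k"
        using s2(2) s3(2) 5(2) k2 by (auto simp: agree_def)
      have "output_set n s3 = output_set n s1"
        using s2(2) s3(2) by (intro output_set_cong) (auto simp: agree_def)
      then have out3: "output_set n s3 = candidate ` {j \<in> kept. j < k}" using 5(2) by simp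
      show "runs n sol T (Cond (ILess (INum 0) (ivar ''z'')) emit_com Skip) s3 (7 * n + 7 + T)
        (\<lambda>s'. imem s' ''b'' 0 = imem s' ''m'' 0 * n \<and>
          output_set n s' = candidate ` {j \<in> kept. j < Suc k})"
      proof (cases "k \<in> kept")
        case True
        then have "{j \<in> kept. j < Suc k} = insert k {j \<in> kept. j < k}" by auto
        then have "runs n sol T emit_com s3 (7 * n + 6 + T)
          (\<lambda>s'. imem s' ''b'' 0 = imem s' ''m'' 0 * n \<and>
            output_set n s' = candidate ` {j \<in> kept. j < Suc k})"
          using runs_emit[OF ready3 b3] by (simp add: out3 k3)
        with True s3(1) show ?thesis by (simp add: ac_simps)
      next
        case False
        then have "{j \<in> kept. j < Suc k} = {j \<in> kept. j < k}" by (auto simp: less_Suc_eq)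
        with False s3(1) b3 out3 show ?thesis by simp
      qed
    qed simp
  qed simp
next
  case (7 s')
  moreover have "{j \<in> kept. j < Suc n} = kept" by (auto simp: selected_def)
  ultimately show ?case by simp
qed (use s in \<open>auto simp: ready_def loaded_def agree_def\<close>)

text \<open>The phases take time of order \<open>n * n + n * T\<close>; the quadratic part is
  absorbed because the solver has to write its answer, so \<open>n \<le> T\<close>.\<close>

lemma runs_main:
  "runs n sol T main_com (input_state n c0 d) (200 * (n * T))
     (\<lambda>s'. output_set n s' = candidate ` kept)"
  unfolding main_com_def
proof (rule runs_Seq[OF runs_penalty[OF loaded_input_state]])
  fix s1
  assume s1: "rmem s1 ''M'' 0 = penalty"
    "agree (iwrites penalty_com) (rwrites penalty_com) (input_state n c0 d) s1"
  have "loaded s1" by (rule loaded_agree[OF loaded_input_state s1(2)]) auto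
  with s1(1) have ready1: "ready s1" by (simp add: ready_def)
  show "runs n sol T (Seq survey_com select_com) s1
    (Suc n * (9 * n + 8 + T) + 2 + (Suc n * (15 * n + 23 + T) + 2))
    (\<lambda>s'. output_set n s' = candidate ` kept)"
  proof (rule runs_Seq[OF runs_survey[OF ready1]])
    fix s2
    assume s2: "surveyed s2" "agree (iwrites survey_com) (rwrites survey_com) s1 s2"
    have "ready s2" by (rule ready_agree[OF ready1 s2(2)]) auto
    moreover have "imem s2 ''m'' 0 = 0" "imem s2 ''b'' 0 = 0"
      using s1(2) s2(2) by (auto simp: agree_def input_state_def)
    ultimately show "runs n sol T select_com s2 (Suc n * (15 * n + 23 + T) + 2)
      (\<lambda>s'. output_set n s' = candidate ` kept)"
      using s2(1) by (intro runs_select)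
  qed simp
next
  have nT: "n \<le> T" using solver by (simp add: nominal_solver_def)
  have T1: "1 \<le> T" using nT n_pos by simp
  have "T \<le> n * T" using n_pos by simp
  then have lin: "n \<le> n * T" "1 \<le> n * T"
    using nT T1 by auto
  \<comment> \<open>From \<open>1 \<le> n\<close>, \<open>n \<le> T\<close> and
    \<open>1 \<le> T\<close>: the coefficients 9, 8 and 1 add up to 18, and below 15, 23 and 1 to
    39. The two loops thus take \<open>36 + 78\<close> multiples of \<open>n * T\<close>, the rest
    at most 10, well within 200.\<close>
  have "Suc n * (9 * n + 8 + T) \<le> (2 * n) * (18 * T)"
    using n_pos nT T1 by (intro mult_le_mono) auto
  moreover have "Suc n * (15 * n + 23 + T) \<le> (2 * n) * (39 * T)"
    using n_pos nT T1 by (intro mult_le_mono) auto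
  ultimately show "3 * n + 3 + (Suc n * (9 * n + 8 + T) + 2 + (Suc n * (15 * n + 23 + T) + 2))
      \<le> 200 * (n * T)"
    using lin by simp
qed

end

theorem theorem12:
  "\<exists>(p :: com) (K :: nat). \<forall>(n :: nat) (X :: real vec set) (c0 :: real vec) (d :: real vec)
      (sol :: real vec \<Rightarrow> real vec) (T :: nat).
     n \<ge> 1 \<longrightarrow> X \<noteq> {} \<longrightarrow> X \<subseteq> binary_vecs n \<longrightarrow>
     c0 \<in> carrier_vec n \<longrightarrow> (\<forall>i<n. 0 \<le> c0 $ i) \<longrightarrow>
     d \<in> carrier_vec n \<longrightarrow> (\<forall>i<n. 0 < d $ i) \<longrightarrow>
     nominal_solver n X sol T \<longrightarrow>
     (\<exists>t s. exec n sol T p (input_state n c0 d) t s \<and> t \<le> K * (n * T) \<and>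
        variable_sized_solution n X c0 d (output_set n s) \<and>
        card (output_set n s) \<le> n)"
proof (rule exI[of _ main_com], rule exI[of _ 200], intro allI impI)
  fix n T :: nat and X :: "real vec set" and c0 d :: "real vec" and sol :: "real vec \<Rightarrow> real vec"
  assume "1 \<le> n" "X \<noteq> {}" "X \<subseteq> binary_vecs n" "c0 \<in> carrier_vec n" "\<forall>i<n. 0 \<le> c0 $ i"
    "d \<in> carrier_vec n" "\<forall>i<n. 0 < d $ i" "nominal_solver n X sol T"
  then interpret robust_instance n X c0 d sol T
    by unfold_locales auto
  show "\<exists>t s. exec n sol T main_com (input_state n c0 d) t s \<and> t \<le> 200 * (n * T) \<and>
      variable_sized_solution n X c0 d (output_set n s) \<and> card (output_set n s) \<le> n"
    using runs_main candidates_solution card_candidates unfolding runs_def by metis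
qed

end
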